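(* Let $a,b$ be positive real numbers, let $\nu\in(0,1)$, let $n\ge1$ be an integer, and put $h=\frac{b}{a}$. Then $$(1-\nu)a+\nu b\;\le\;K(h^{\frac{1}{2^n}},2)^{-r_n}\,a^{1-\nu}b^{\nu}+(\sqrt a-\sqrt b)^2-\sum_{k=0}^{n-1}r_k\Big[\big(a^{\frac{m_k}{2^k}}b^{1-\frac{m_k}{2^k}}\big)^{\frac12}-\big(a^{\frac{m_k+1}{2^k}}b^{1-\frac{m_k+1}{2^k}}\big)^{\frac12}\Big]^2.$$
   Context: For $t>0$, $K(t,2)=\frac{(1+t)^2}{4t}$ (Kantorovich constant). For $\nu\in[0,1]$ and integers $k\ge 0$: $m_k=\lfloor 2^k\nu\rfloor$; $r_0=\min\{\nu,1-\nu\}$ and $r_k=\min\{2r_{k-1},1-2r_{k-1}\}$ for $k\ge 1$. *)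

theory Defs
  imports Complex_Main
begin

text \<open>The Kantorovich constant \<open>K(t,2)\<close>, used for \<open>t > 0\<close>.\<close>

definition kantorovich2 :: "real \<Rightarrow> real" where
  "kantorovich2 t = (1 + t)\<^sup>2 / (4 * t)"

definition m :: "real \<Rightarrow> nat \<Rightarrow> int" where
  "m \<nu> k = \<lfloor>2 ^ k * \<nu>\<rfloor>"

fun r :: "real \<Rightarrow> nat \<Rightarrow> real" where
  "r \<nu> 0 = min \<nu> (1 - \<nu>)"
| "r \<nu> (Suc k) = min (2 * r \<nu> k) (1 - 2 * r \<nu> k)"

end

theory Submission
  imports Defs
begin

text \<open>
  Put \<open>g x = a\<^sup>x b\<^sup>1\<^sup>-\<^sup>x\<close> and let \<open>L\<^sub>n\<close> be the piecewise linear interpolation of \<open>g\<close> on the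
  grid of mesh \<open>2\<^sup>-\<^sup>n\<close>. Since \<open>r\<^sub>k\<close> is the distance from \<open>2\<^sup>k \<nu>\<close> to the nearest integer and \<open>g\<close> at a
  midpoint is the geometric mean of its values at the end points, the \<open>k\<close>-th summand is
  \<open>L\<^sub>k \<nu> - L\<^sub>k\<^sub>+\<^sub>1 \<nu>\<close>, so subtracting the sum from \<open>\<nu> a + (1 - \<nu>) b\<close> leaves \<open>L\<^sub>n \<nu>\<close>. The
  two-point arithmetic-geometric mean inequality with Kantorovich constant on the grid cell
  containing \<open>\<nu>\<close> gives \<open>L\<^sub>n \<nu> \<ge> K\<^sup>r g \<nu>\<close>, and the claim follows from
  \<open>K\<^sup>r g \<nu> + K\<^sup>-\<^sup>r g (1 - \<nu>) \<ge> 2 \<surd>(a b)\<close>.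
\<close>

text \<open>\<open>ln\<close> lies below its tangent at the weighted mean \<open>M\<close>;
  averaging this bound over \<open>A\<close> and \<open>B\<close> cancels the linear terms.\<close>

lemma weighted_am_gm:
  fixes A B s :: real
  assumes "A > 0" "B > 0" "0 \<le> s" "s \<le> 1"
  shows "A powr (1 - s) * B powr s \<le> (1 - s) * A + s * B"
proof -
  define M where "M = (1 - s) * A + s * B"
  have "M > 0"
  proof (cases "s = 0")
    case True
    then show ?thesis using assms by (simp add: M_def)
  next
    case False
    then show ?thesis using assms
      unfolding M_def by (intro add_nonneg_pos mult_pos_pos mult_nonneg_nonneg) auto
  qed
  have tangent: "ln x \<le> ln M + (x / M - 1)" if "x > 0" for x
    using ln_le_minus_one[of "x / M"] that \<open>M > 0\<close> by (simp add: ln_div)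
  have "(1 - s) * ln A + s * ln B
      \<le> (1 - s) * (ln M + (A / M - 1)) + s * (ln M + (B / M - 1))"
    using assms by (intro add_mono mult_left_mono tangent) auto
  also have "\<dots> = ln M + (((1 - s) * A + s * B) / M - 1)"
    by (simp add: algebra_simps add_divide_distrib diff_divide_distrib)
  also have "\<dots> = ln M"
    using \<open>M > 0\<close> by (simp flip: M_def)
  finally have "exp ((1 - s) * ln A + s * ln B) \<le> M"
    using \<open>M > 0\<close> by (metis exp_le_cancel_iff exp_ln)
  then show ?thesis
    using assms by (simp add: powr_def exp_add M_def)
qed

lemma kantorovich2_pos: "t > 0 \<Longrightarrow> kantorovich2 t > 0"
  by (simp add: kantorovich2_def add_pos_pos)

lemma kantorovich2_divide:
  assumes "A > 0" "B > 0"
  shows "kantorovich2 (B / A) = (A + B)\<^sup>2 / (4 * A * B)"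
  using assms by (simp add: kantorovich2_def field_simps power2_eq_square)

lemma kantorovich2_divide_commute:
  assumes "A > 0" "B > 0"
  shows "kantorovich2 (A / B) = kantorovich2 (B / A)"
  using assms by (simp add: kantorovich2_divide add.commute mult_ac)

text \<open>For \<open>t \<le> 1/2\<close> the right-hand side is \<open>(1 - 2t) A + 2t (A + B)/2\<close>, and the left-hand side
  is the corresponding weighted geometric mean of \<open>A\<close> and \<open>(A + B)/2\<close>.\<close>

lemma kantorovich_am_gm_half:
  fixes A B t :: real
  assumes "A > 0" "B > 0" "0 \<le> t" "t \<le> 1 / 2"
  shows "kantorovich2 (B / A) powr t * (A powr (1 - t) * B powr t) \<le> (1 - t) * A + t * B"
proof -
  define C where "C = (A + B) / 2"
  have "C > 0" using assms by (simp add: C_def)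
  have "kantorovich2 (B / A) = C\<^sup>2 / (A * B)"
    using assms by (simp add: kantorovich2_divide C_def power_divide)
  then have "ln (kantorovich2 (B / A)) = 2 * ln C - ln A - ln B"
    using assms \<open>C > 0\<close> by (simp add: ln_div ln_mult ln_realpow)
  then have "kantorovich2 (B / A) powr t * (A powr (1 - t) * B powr t)
      = exp (t * (2 * ln C - ln A - ln B) + ((1 - t) * ln A + t * ln B))"
    using assms kantorovich2_pos[of "B / A"] by (simp add: powr_def exp_add)
  also have "\<dots> = exp ((1 - 2 * t) * ln A + 2 * t * ln C)"
    by (simp add: algebra_simps)
  also have "\<dots> = A powr (1 - 2 * t) * C powr (2 * t)"
    using assms \<open>C > 0\<close> by (simp add: powr_def exp_add)
  also have "\<dots> \<le> (1 - 2 * t) * A + 2 * t * C"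
    using assms \<open>C > 0\<close> by (intro weighted_am_gm) auto
  also have "\<dots> = (1 - t) * A + t * B"
    by (simp add: C_def algebra_simps)
  finally show ?thesis .
qed

text \<open>Swapping \<open>A\<close> with \<open>B\<close> and \<open>t\<close> with
  \<open>1 - t\<close> preserves the constant and reduces \<open>t > 1/2\<close> to the half-range
  case.\<close>

lemma kantorovich_am_gm:
  fixes A B t :: real
  assumes "A > 0" "B > 0" "0 \<le> t" "t \<le> 1"
  shows "kantorovich2 (B / A) powr (min t (1 - t)) * (A powr (1 - t) * B powr t)
    \<le> (1 - t) * A + t * B"
proof (cases "t \<le> 1 / 2")
  case True
  then show ?thesis using kantorovich_am_gm_half[of A B t] assms by (simp add: min_def)
next
  case False
  then show ?thesis
    using kantorovich_am_gm_half[of B A "1 - t"] assms kantorovich2_divide_commute[of A B]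
    by (simp add: min_def mult_ac add.commute)
qed

text \<open>Passing from \<open>k\<close> to \<open>Suc k\<close> appends the next binary digit of
  \<open>\<nu>\<close>, which is 0 exactly when \<open>\<nu>\<close> lies in the left half of its
  cell.\<close>

lemma m_Suc:
  "m \<nu> (Suc k) = (if frac (2 ^ k * \<nu>) < 1 / 2 then 2 * m \<nu> k else 2 * m \<nu> k + 1)"
  unfolding m_def frac_def power_Suc by (auto simp: floor_eq_iff) linarith+

lemma frac_pow2_Suc:
  fixes \<nu> :: real
  shows "frac (2 ^ Suc k * \<nu>) = (if frac (2 ^ k * \<nu>) < 1 / 2 then 2 * frac (2 ^ k * \<nu>)
    else 2 * frac (2 ^ k * \<nu>) - 1)"
  using m_Suc[of \<nu> k] by (auto simp: m_def frac_def algebra_simps)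

text \<open>Doubling modulo 1 turns a distance \<open>d\<close> to the nearest integer into
  \<open>min (2 * d) (1 - 2 * d)\<close>, which is the recursion of \<open>r\<close>.\<close>

lemma r_eq_frac:
  assumes "0 < \<nu>" "\<nu> < 1"
  shows "r \<nu> k = min (frac (2 ^ k * \<nu>)) (1 - frac (2 ^ k * \<nu>))"
proof (induction k)
  case 0
  have "frac \<nu> = \<nu>" using assms by (simp add: frac_eq)
  then show ?case by simp
next
  case (Suc k)
  show ?case
    unfolding r.simps Suc.IH frac_pow2_Suc
    using frac_lt_1[of "2 ^ k * \<nu>"] frac_ge_0[of "2 ^ k * \<nu>"] by (auto simp: min_def)
qed

text \<open>The weight \<open>x\<close> sits on \<open>a\<close>, so the mean
  \<open>a powr (1 - \<nu>) * b powr \<nu>\<close> of the theorem is the value at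
  \<open>1 - \<nu>\<close>, not at \<open>\<nu>\<close>.\<close>

definition geo :: "real \<Rightarrow> real \<Rightarrow> real \<Rightarrow> real" where
  "geo a b x = a powr x * b powr (1 - x)"

lemma geo_pos: "a > 0 \<Longrightarrow> b > 0 \<Longrightarrow> geo a b x > 0"
  by (simp add: geo_def)

lemma geo_eq_exp: "a > 0 \<Longrightarrow> b > 0 \<Longrightarrow> geo a b x = exp (x * ln a + (1 - x) * ln b)"
  by (simp add: geo_def powr_def exp_add)

lemma ln_geo: "a > 0 \<Longrightarrow> b > 0 \<Longrightarrow> ln (geo a b x) = x * ln a + (1 - x) * ln b"
  by (simp add: geo_eq_exp)

text \<open>\<open>ln (geo a b x)\<close> is affine in \<open>x\<close>, so the cross term of the
  square is twice the value at the midpoint.\<close>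

lemma sq_diff_sqrt_geo:
  assumes "a > 0" "b > 0"
  shows "(geo a b x powr (1 / 2) - geo a b y powr (1 / 2))\<^sup>2
    = geo a b x + geo a b y - 2 * geo a b ((x + y) / 2)"
proof -
  have "geo a b ((x + y) / 2) = sqrt (geo a b x) * sqrt (geo a b y)"
  proof -
    have "(geo a b ((x + y) / 2))\<^sup>2 = geo a b x * geo a b y"
      using assms by (simp add: geo_eq_exp power2_eq_square field_simps flip: exp_add)
    then show ?thesis
      using geo_pos[OF assms] by (metis real_sqrt_mult real_sqrt_unique less_imp_le)
  qed
  then show ?thesis
    using geo_pos[OF assms, of x] geo_pos[OF assms, of y]
    by (simp add: powr_half_sqrt power2_diff less_imp_le)
qed

text \<open>The fractional part is the local coordinate of \<open>\<nu>\<close> in its dyadic cell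
  of length \<open>1 / 2 ^ k\<close>.\<close>

definition interp :: "real \<Rightarrow> real \<Rightarrow> real \<Rightarrow> nat \<Rightarrow> real" where
  "interp a b \<nu> k = (1 - frac (2 ^ k * \<nu>)) * geo a b (real_of_int (m \<nu> k) / 2 ^ k)
    + frac (2 ^ k * \<nu>) * geo a b ((real_of_int (m \<nu> k) + 1) / 2 ^ k)"

lemma interp_Suc:
  assumes "a > 0" "b > 0" "0 < \<nu>" "\<nu> < 1"
  shows "interp a b \<nu> k - interp a b \<nu> (Suc k) = r \<nu> k *
    (geo a b (real_of_int (m \<nu> k) / 2 ^ k) powr (1 / 2)
      - geo a b ((real_of_int (m \<nu> k) + 1) / 2 ^ k) powr (1 / 2))\<^sup>2"
proof -
  define t where "t = frac (2 ^ k * \<nu>)"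
  define x where "x = real_of_int (m \<nu> k) / 2 ^ k"
  define y where "y = (real_of_int (m \<nu> k) + 1) / 2 ^ k"
  have base: "interp a b \<nu> k = (1 - t) * geo a b x + t * geo a b y"
    by (simp add: interp_def t_def x_def y_def)
  have mid: "(x + y) / 2 = (2 * real_of_int (m \<nu> k) + 1) / 2 ^ Suc k"
    by (simp add: x_def y_def field_simps)
  have x: "2 * real_of_int (m \<nu> k) / 2 ^ Suc k = x"
    and y: "(2 * real_of_int (m \<nu> k) + 2) / 2 ^ Suc k = y"
    by (simp_all add: x_def y_def field_simps)
  have "interp a b \<nu> k - interp a b \<nu> (Suc k)
      = min t (1 - t) * (geo a b x + geo a b y - 2 * geo a b ((x + y) / 2))"
  proof (cases "t < 1 / 2")
    \<comment> \<open>The next cell is the left half: local coordinate \<open>2 * t\<close>, with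
      the midpoint as right end. In the other case it is the right half, with coordinate
      \<open>2 * t - 1\<close>.\<close>
    case True
    then have "interp a b \<nu> (Suc k) = (1 - 2 * t) * geo a b x + 2 * t * geo a b ((x + y) / 2)"
      by (simp add: interp_def m_Suc frac_pow2_Suc mid x t_def del: power_Suc)
    with True show ?thesis
      by (simp add: base min_def algebra_simps)
  next
    case False
    then have "interp a b \<nu> (Suc k)
        = (2 - 2 * t) * geo a b ((x + y) / 2) + (2 * t - 1) * geo a b y"
      by (simp add: interp_def m_Suc frac_pow2_Suc mid y t_def add.assoc del: power_Suc)
    moreover have "min t (1 - t) = 1 - t"
      using False by simp
    ultimately show ?thesis
      by (simp add: base algebra_simps)
  qed
  then show ?thesis
    using assms by (simp add: sq_diff_sqrt_geo r_eq_frac flip: t_def x_def y_def)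
qed

lemma interp_0:
  assumes "a > 0" "b > 0" "0 < \<nu>" "\<nu> < 1"
  shows "interp a b \<nu> 0 = \<nu> * a + (1 - \<nu>) * b"
proof -
  have "\<lfloor>\<nu>\<rfloor> = 0" "frac \<nu> = \<nu>" using assms by (simp_all add: floor_eq_iff frac_eq)
  then show ?thesis using assms by (simp add: interp_def m_def geo_def)
qed

lemma interp_ge:
  assumes "a > 0" "b > 0" "0 < \<nu>" "\<nu> < 1"
  shows "kantorovich2 ((b / a) powr (1 / 2 ^ n)) powr r \<nu> n * geo a b \<nu> \<le> interp a b \<nu> n"
proof -
  define t where "t = frac (2 ^ n * \<nu>)"
  define x where "x = real_of_int (m \<nu> n) / 2 ^ n"
  define y where "y = (real_of_int (m \<nu> n) + 1) / 2 ^ n"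
  have t: "0 \<le> t" "t \<le> 1"
    using frac_lt_1[of "2 ^ n * \<nu>"] by (simp_all add: t_def)
  have pos: "geo a b x > 0" "geo a b y > 0"
    using assms by (simp_all add: geo_pos)
  have "(1 - t) * x + t * y = \<nu>"
    by (simp add: x_def y_def t_def frac_def m_def field_simps)
  moreover have "geo a b x powr (1 - t) * geo a b y powr t = geo a b ((1 - t) * x + t * y)"
  proof -
    have "geo a b x powr (1 - t) * geo a b y powr t
        = exp ((1 - t) * (x * ln a + (1 - x) * ln b) + t * (y * ln a + (1 - y) * ln b))"
      using assms pos by (simp add: powr_def ln_geo exp_add)
    also have "\<dots> = geo a b ((1 - t) * x + t * y)"
      unfolding geo_eq_exp[OF assms(1,2)] by (rule arg_cong[where f = exp]) (simp add: algebra_simps)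
    finally show ?thesis .
  qed
  ultimately have geo: "geo a b x powr (1 - t) * geo a b y powr t = geo a b \<nu>"
    by simp
  have "y = x + 1 / 2 ^ n" by (simp add: x_def y_def add_divide_distrib)
  \<comment> \<open>The ratio of neighbouring grid values is the same in every cell. It appears
    inverted here, which the symmetry of the Kantorovich constant absorbs.\<close>
  then have "(b / a) powr (1 / 2 ^ n) = geo a b x / geo a b y"
    using assms by (simp add: powr_def geo_eq_exp ln_div algebra_simps diff_divide_distrib flip: exp_diff)
  then have "kantorovich2 ((b / a) powr (1 / 2 ^ n)) = kantorovich2 (geo a b y / geo a b x)"
    using pos by (simp add: kantorovich2_divide_commute)
  then show ?thesis
    using kantorovich_am_gm[OF pos t] assms
    by (simp add: geo r_eq_frac interp_def flip: t_def x_def y_def)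
qed

theorem theorem2p3:
  fixes a b \<nu> h :: real and n :: nat
  assumes "a > 0" and "b > 0"
    and "0 < \<nu>" and "\<nu> < 1"
    and "n \<ge> 1"
    and "h = b / a"
  shows "(1 - \<nu>) * a + \<nu> * b \<le>
    kantorovich2 (h powr (1 / 2 ^ n)) powr (- r \<nu> n) * (a powr (1 - \<nu>) * b powr \<nu>)
    + (sqrt a - sqrt b)\<^sup>2
    - (\<Sum>k<n. r \<nu> k *
        ((a powr (real_of_int (m \<nu> k) / 2 ^ k)
            * b powr (1 - real_of_int (m \<nu> k) / 2 ^ k)) powr (1 / 2)
         - (a powr ((real_of_int (m \<nu> k) + 1) / 2 ^ k)
            * b powr (1 - (real_of_int (m \<nu> k) + 1) / 2 ^ k)) powr (1 / 2))\<^sup>2)"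
    (is "_ \<le> ?K powr _ * _ + _ - ?S")
proof -
  have "?S = (\<Sum>k<n. interp a b \<nu> k - interp a b \<nu> (Suc k))"
    using assms by (simp add: interp_Suc flip: geo_def)
  also have "\<dots> = \<nu> * a + (1 - \<nu>) * b - interp a b \<nu> n"
    using assms by (simp add: sum_lessThan_telescope' interp_0)
  finally have S: "?S = \<nu> * a + (1 - \<nu>) * b - interp a b \<nu> n" .

  \<comment> \<open>The powers of \<open>?K\<close> are opposite and the two means multiply to
    \<open>a * b\<close>, so a lower bound for \<open>P + Q\<close> comes from AM-GM.\<close>
  define P where "P = ?K powr r \<nu> n * geo a b \<nu>"
  define Q where "Q = ?K powr (- r \<nu> n) * (a powr (1 - \<nu>) * b powr \<nu>)"
  have "?K > 0" using assms by (simp add: kantorovich2_pos)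
  then have "P > 0" "Q > 0" using assms by (simp_all add: P_def Q_def geo_pos)
  have "P * Q = (?K powr r \<nu> n * ?K powr (- r \<nu> n))
      * (a powr \<nu> * a powr (1 - \<nu>)) * (b powr (1 - \<nu>) * b powr \<nu>)"
    by (simp add: P_def Q_def geo_def mult_ac)
  also have "\<dots> = a * b"
    using \<open>?K > 0\<close> assms by (simp flip: powr_add)
  finally have "sqrt a * sqrt b = sqrt P * sqrt Q"
    by (simp flip: real_sqrt_mult)
  moreover have "0 \<le> (sqrt P - sqrt Q)\<^sup>2" by simp
  ultimately have "2 * (sqrt a * sqrt b) \<le> P + Q"
    using \<open>P > 0\<close> \<open>Q > 0\<close> by (simp add: power2_diff)
  moreover have "P \<le> interp a b \<nu> n"
    using assms interp_ge by (simp add: P_def)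
  moreover have "(sqrt a - sqrt b)\<^sup>2 = a + b - 2 * (sqrt a * sqrt b)"
    using assms by (simp add: power2_diff)
  \<comment> \<open>After substituting \<open>S\<close>, the terms linear in \<open>a\<close> and
    \<open>b\<close> cancel and the claim reads
    \<open>2 * sqrt a * sqrt b \<le> Q + interp a b \<nu> n\<close>.\<close>
  ultimately show ?thesis
    unfolding S Q_def[symmetric] by (simp add: algebra_simps)
qed

end
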